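(* Let $p_k$ be the dual variable of the $k$-th iterate of the FC-GCG method for $V=P_0(\mathcal{T})$, and let $\bar\lambda_k$, the problems $(P_\lambda)$: $\min_{E\in\mathcal{S}_{\mathcal{T}}(\Omega)}j_\lambda(E)$ with $j_\lambda(E)=\mathrm{Per}(E,\Omega)-\lambda\int_Ep_k\,dx$, and the value function $G(\lambda)=\min_{E\in\mathcal{S}_{\mathcal{T}}(\Omega)}j_\lambda(E)$, $\lambda\ge0$, be defined as in the context. Then: 1. $G(\lambda)\le0$ for all $\lambda\ge0$, with equality if and only if $\lambda\le\bar\lambda_k$. 2. For $0\le\lambda<\bar\lambda_k$, the solutions of $(P_\lambda)$ are given by $E_\lambda=\emptyset$ and $E_\lambda=\Omega$. 3. A set $\bar E\in\mathcal{S}_{\mathcal{T}}(\Omega)$ with $\mathrm{Per}(\bar E,\Omega)\neq0$ is a solution of $(P_\lambda)$ for $\lambda=\bar\lambda_k$ if and only if it is a maximizer of $$\max_{E\in\mathcal{S}_{\mathcal{T}}(\Omega)}\frac{\int_Ep_k\,dx}{\mathrm{Per}(E,\Omega)}.$$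
   Context: $\Omega\subset\mathbb{R}^d$ ($d\ge 2$) is a bounded polyhedral (connected) domain with strongly Lipschitz boundary; $\mathcal{T}=\{T_1,\dots,T_n\}$ is a triangulation: pairwise disjoint open simplices with $\overline\Omega=\bigcup_i\overline{T_i}$. $P_0(\mathcal{T})$ is the space of functions constant on each simplex; $\mathcal{S}_{\mathcal{T}}(\Omega)$ is the class of open sets that are interiors of unions of closures of simplices of $\mathcal{T}$ (including $\emptyset$ and $\Omega$). $\mathrm{TV}$ is the usual isotropic total variation in $\Omega$, $\mathrm{Per}(E,\Omega)=\mathrm{TV}(\mathbb{1}_E,\Omega)$. FC-GCG method with $V=P_0(\mathcal{T})$ for $\min_{u\in V}F(Ku)+\mathrm{TV}(u,\Omega)$: $Y$ is a separable Hilbert space, $K:V\to Y$ linear and continuous, $F:Y\to\mathbb{R}$ thrice continuously Fréchet differentiable, strictly convex, $F\ge0$, and with $K_{\mathbb{1}}=K\mathbb{1}_\Omega$ for every $y$ the map $c\mapsto F(y+cK_{\mathbb{1}})$ has a unique minimizer in $\mathbb{R}$. Let $B=\{u\in V:\int_\Omega u\,dx=0,\ \mathrm{TV}(u,\Omega)\le1\}$. Start with $\mathcal{A}_0=\emptyset$, $u_0=c^0\mathbb{1}_\Omega$, $c^0\in\operatorname{argmin}_cF(cK_{\mathbb{1}})$. In step $k$: $p_k=-K^*\nabla F(Ku_k)$; pick an extremal point $\widehat v_k$ of $B$ maximizing $v\mapsto\int_\Omega p_kv\,dx$; stop if the maximum is $\le1$; otherwise let $\mathcal{A}_k^+=\mathcal{A}_k\cup\{\widehat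 v_k\}=\{v_1,\dots,v_N\}$, let $(\gamma^{k+1},c^{k+1})$ minimize $F(\sum_i\gamma_iKv_i+cK_{\mathbb{1}})+\sum_i\gamma_i$ over $\gamma\ge0$, $c\in\mathbb{R}$, put $u_{k+1}=\sum_i\gamma_i^{k+1}v_i+c^{k+1}\mathbb{1}_\Omega$ and obtain $\mathcal{A}_{k+1}$ from $\mathcal{A}_k^+$ by removing elements with zero weight. The dual variable $p_k$ is identified with an element of $P_0(\mathcal{T})$ (via the $L^2$ inner product) and satisfies $\int_\Omega p_k\,dx=0$. $\bar\lambda_k:=\Big(\max_{E}\frac{\int_Ep_k\,dx}{\mathrm{Per}(E,\Omega)}\Big)^{-1}$, the maximum being over $E\in\mathcal{S}_{\mathcal{T}}(\Omega)$ with $\mathrm{Per}(E,\Omega)\ne0$; it is a standing assumption that the maximum is at least $1$, i.e. $0<\bar\lambda_k\le1$. *)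

theory Defs
  imports "HOL-Analysis.Analysis"
begin

section \<open>Domains and triangulations\<close>

definition polyhedral :: "'a::euclidean_space set \<Rightarrow> bool" where
  "polyhedral \<Omega> \<longleftrightarrow> (\<exists>\<P>. finite \<P> \<and> (\<forall>P\<in>\<P>. polytope P) \<and> closure \<Omega> = \<Union>\<P>)"

text \<open>Near each boundary point, \<open>\<Omega>\<close> is the part lying strictly above the graph of a Lipschitz
  function; the graph is taken over the hyperplane orthogonal to the unit vector \<open>e\<close>.\<close>
definition strongly_lipschitz :: "'a::euclidean_space set \<Rightarrow> bool" where
  "strongly_lipschitz \<Omega> \<longleftrightarrow>
     (\<forall>x\<in>frontier \<Omega>. \<exists>U e g L. open U \<and> x \<in> U \<and> norm e = 1 \<and>
        L-lipschitz_on {z. z \<bullet> e = 0} g \<and>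
        \<Omega> \<inter> U = {y \<in> U. g (y - (y \<bullet> e) *\<^sub>R e) < y \<bullet> e})"

text \<open>No face-to-face condition is imposed, in contrast to \<open>triangulation\<close> in the library.\<close>
definition triangulates :: "'a::euclidean_space set set \<Rightarrow> 'a set \<Rightarrow> bool" where
  "triangulates \<T> \<Omega> \<longleftrightarrow>
     finite \<T> \<and>
     (\<forall>T\<in>\<T>. \<exists>S. int DIM('a) simplex S \<and> T = interior S) \<and>
     pairwise disjnt \<T> \<and>
     closure \<Omega> = (\<Union>T\<in>\<T>. closure T)"

definition simplicial_sets :: "'a::euclidean_space set set \<Rightarrow> 'a set set" where
  "simplicial_sets \<T> = {interior (\<Union>T\<in>\<S>. closure T) |\<S>. \<S> \<subseteq> \<T>}"

section \<open>Total variation and perimeter\<close>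

definition divergence :: "('a::euclidean_space \<Rightarrow> 'a) \<Rightarrow> 'a \<Rightarrow> real" where
  "divergence \<phi> x = (\<Sum>b\<in>Basis. frechet_derivative \<phi> (at x) b \<bullet> b)"

text \<open>Continuously differentiable vector fields with compact support in \<open>\<Omega>\<close>.\<close>
definition C1c :: "'a::euclidean_space set \<Rightarrow> ('a \<Rightarrow> 'a) set" where
  "C1c \<Omega> = {\<phi>. (\<exists>\<phi>' :: 'a \<Rightarrow> 'a \<Rightarrow>\<^sub>L 'a.
                   (\<forall>x. (\<phi> has_derivative blinfun_apply (\<phi>' x)) (at x)) \<and> continuous_on UNIV \<phi>') \<and>
                compact (closure {x. \<phi> x \<noteq> 0}) \<and> closure {x. \<phi> x \<noteq> 0} \<subseteq> \<Omega>}"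

definition TV :: "('a::euclidean_space \<Rightarrow> real) \<Rightarrow> 'a set \<Rightarrow> ereal" where
  "TV u \<Omega> = (SUP \<phi>\<in>{\<phi>\<in>C1c \<Omega>. \<forall>x. norm (\<phi> x) \<le> 1}.
               ereal (LINT x:\<Omega>|lebesgue. u x * divergence \<phi> x))"

definition Per :: "'a::euclidean_space set \<Rightarrow> 'a set \<Rightarrow> ereal" where
  "Per E \<Omega> = TV (indicator E) \<Omega>"

section \<open>Piecewise constant functions\<close>

text \<open>Elements of \<open>P0 \<T>\<close> are representatives: only their values almost everywhere in \<open>\<Omega>\<close> matter.
  Values on the (null) skeleton of the triangulation and outside \<open>\<Omega>\<close> are arbitrary.\<close>
definition P0 :: "'a::euclidean_space set set \<Rightarrow> ('a \<Rightarrow> real) set" where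
  "P0 \<T> = {u. \<forall>T\<in>\<T>. u constant_on T}"

definition ae_eq_on :: "'a::euclidean_space set \<Rightarrow> ('a \<Rightarrow> real) \<Rightarrow> ('a \<Rightarrow> real) \<Rightarrow> bool" where
  "ae_eq_on \<Omega> u v \<longleftrightarrow> (AE x in lebesgue. x \<in> \<Omega> \<longrightarrow> u x = v x)"

definition unit_TV_ball :: "'a::euclidean_space set set \<Rightarrow> 'a set \<Rightarrow> ('a \<Rightarrow> real) set" where
  "unit_TV_ball \<T> \<Omega> = {u \<in> P0 \<T>. (LINT x:\<Omega>|lebesgue. u x) = 0 \<and> TV u \<Omega> \<le> 1}"

text \<open>Extremal points of a set of functions, up to equality almost everywhere in \<open>\<Omega>\<close>.\<close>
definition extremal_mod_ae ::
    "'a::euclidean_space set \<Rightarrow> ('a \<Rightarrow> real) set \<Rightarrow> ('a \<Rightarrow> real) \<Rightarrow> bool" where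
  "extremal_mod_ae \<Omega> B v \<longleftrightarrow> v \<in> B \<and>
     (\<forall>a\<in>B. \<forall>b\<in>B. \<forall>t\<in>{0<..<1::real}.
        ae_eq_on \<Omega> v (\<lambda>x. (1 - t) * a x + t * b x) \<longrightarrow> ae_eq_on \<Omega> a b)"

text \<open>Linearity, and boundedness with respect to the norm of \<open>L\<^sup>2(\<Omega>)\<close>. The latter makes
  \<open>K\<close> independent of the choice of representatives.\<close>
definition linear_continuous_on_P0 ::
    "'a::euclidean_space set set \<Rightarrow> 'a set \<Rightarrow> (('a \<Rightarrow> real) \<Rightarrow> 'y::real_normed_vector) \<Rightarrow> bool" where
  "linear_continuous_on_P0 \<T> \<Omega> K \<longleftrightarrow>
     (\<forall>u\<in>P0 \<T>. \<forall>v\<in>P0 \<T>. K (\<lambda>x. u x + v x) = K u + K v) \<and>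
     (\<forall>a. \<forall>u\<in>P0 \<T>. K (\<lambda>x. a * u x) = a *\<^sub>R K u) \<and>
     (\<exists>C. \<forall>u\<in>P0 \<T>. norm (K u) \<le> C * sqrt (LINT x:\<Omega>|lebesgue. (u x)\<^sup>2))"

section \<open>The fidelity term\<close>

definition thrice_continuously_differentiable :: "('y::real_normed_vector \<Rightarrow> real) \<Rightarrow> bool" where
  "thrice_continuously_differentiable F \<longleftrightarrow>
     (\<exists>(F1 :: 'y \<Rightarrow> 'y \<Rightarrow>\<^sub>L real) (F2 :: 'y \<Rightarrow> 'y \<Rightarrow>\<^sub>L 'y \<Rightarrow>\<^sub>L real)
       (F3 :: 'y \<Rightarrow> 'y \<Rightarrow>\<^sub>L 'y \<Rightarrow>\<^sub>L 'y \<Rightarrow>\<^sub>L real).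
        (\<forall>y. (F has_derivative blinfun_apply (F1 y)) (at y)) \<and>
        (\<forall>y. (F1 has_derivative blinfun_apply (F2 y)) (at y)) \<and>
        (\<forall>y. (F2 has_derivative blinfun_apply (F3 y)) (at y)) \<and>
        continuous_on UNIV F3)"

definition strictly_convex :: "('y::real_vector \<Rightarrow> real) \<Rightarrow> bool" where
  "strictly_convex F \<longleftrightarrow>
     (\<forall>x y. \<forall>t\<in>{0<..<1}. x \<noteq> y \<longrightarrow>
        F ((1 - t) *\<^sub>R x + t *\<^sub>R y) < (1 - t) * F x + t * F y)"

section \<open>The FC-GCG method\<close>

text \<open>\<open>p = - K\<^sup>* \<nabla>F(K u)\<close>, where the adjoint is taken with respect to the inner product of
  \<open>L\<^sup>2(\<Omega>)\<close>.\<close>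
definition dual_variable ::
    "'a::euclidean_space set set \<Rightarrow> 'a set \<Rightarrow> (('a \<Rightarrow> real) \<Rightarrow> 'y::real_inner) \<Rightarrow> ('y \<Rightarrow> real) \<Rightarrow>
     ('a \<Rightarrow> real) \<Rightarrow> ('a \<Rightarrow> real) \<Rightarrow> bool" where
  "dual_variable \<T> \<Omega> K F u p \<longleftrightarrow> p \<in> P0 \<T> \<and>
     (\<exists>g. GDERIV F (K u) :> g \<and> (\<forall>v\<in>P0 \<T>. (LINT x:\<Omega>|lebesgue. p x * v x) = - (g \<bullet> K v)))"

text \<open>\<open>fcgcg \<T> \<Omega> K F k \<A> u\<close>: the method can reach the active set \<open>\<A>\<^sub>k = \<A>\<close> and the
  iterate \<open>u\<^sub>k = u\<close>. A choice of weights on \<open>\<A>\<^sub>k\<^sup>+\<close> is a function \<open>\<gamma>\<close>, of which only the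
  values on \<open>\<A>\<^sub>k\<^sup>+\<close> are relevant.\<close>
inductive fcgcg ::
    "'a::euclidean_space set set \<Rightarrow> 'a set \<Rightarrow> (('a \<Rightarrow> real) \<Rightarrow> 'y::real_inner) \<Rightarrow> ('y \<Rightarrow> real) \<Rightarrow>
     nat \<Rightarrow> ('a \<Rightarrow> real) set \<Rightarrow> ('a \<Rightarrow> real) \<Rightarrow> bool"
  for \<T> \<Omega> K F where
  start:
    "is_arg_min (\<lambda>c. F (c *\<^sub>R K (indicator \<Omega>))) (\<lambda>_. True) c \<Longrightarrow>
     fcgcg \<T> \<Omega> K F 0 {} (\<lambda>x. c * indicator \<Omega> x)"
| step:
    "\<lbrakk>fcgcg \<T> \<Omega> K F k \<A> u;
      dual_variable \<T> \<Omega> K F u p;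
      is_arg_max (\<lambda>v. LINT x:\<Omega>|lebesgue. p x * v x)
        (extremal_mod_ae \<Omega> (unit_TV_ball \<T> \<Omega>)) vhat;
      (LINT x:\<Omega>|lebesgue. p x * vhat x) > 1;
      \<A>p = insert vhat \<A>;
      is_arg_min
        (\<lambda>(\<gamma>, c). F ((\<Sum>v\<in>\<A>p. \<gamma> v *\<^sub>R K v) + c *\<^sub>R K (indicator \<Omega>)) + (\<Sum>v\<in>\<A>p. \<gamma> v))
        (\<lambda>(\<gamma>, c). \<forall>v\<in>\<A>p. 0 \<le> \<gamma> v) (\<gamma>, c)\<rbrakk> \<Longrightarrow>
     fcgcg \<T> \<Omega> K F (Suc k) {v \<in> \<A>p. \<gamma> v \<noteq> 0}
       (\<lambda>x. (\<Sum>v\<in>\<A>p. \<gamma> v * v x) + c * indicator \<Omega> x)"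

section \<open>The parametric problems\<close>

definition nontrivial_sets :: "'a::euclidean_space set set \<Rightarrow> 'a set \<Rightarrow> 'a set set" where
  "nontrivial_sets \<T> \<Omega> = {E \<in> simplicial_sets \<T>. Per E \<Omega> \<noteq> 0}"

definition ratio :: "'a::euclidean_space set \<Rightarrow> ('a \<Rightarrow> real) \<Rightarrow> 'a set \<Rightarrow> ereal" where
  "ratio \<Omega> p E = ereal (LINT x:E|lebesgue. p x) / Per E \<Omega>"

definition max_ratio :: "'a::euclidean_space set set \<Rightarrow> 'a set \<Rightarrow> ('a \<Rightarrow> real) \<Rightarrow> ereal" where
  "max_ratio \<T> \<Omega> p = Max (ratio \<Omega> p ` nontrivial_sets \<T> \<Omega>)"

text \<open>The denominators in \<open>max_ratio\<close> are nonzero, so the maximum is finite. The coercion is harmless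
  as soon as the maximum is positive.\<close>
definition lambda_bar :: "'a::euclidean_space set set \<Rightarrow> 'a set \<Rightarrow> ('a \<Rightarrow> real) \<Rightarrow> real" where
  "lambda_bar \<T> \<Omega> p = real_of_ereal (inverse (max_ratio \<T> \<Omega> p))"

definition energy :: "'a::euclidean_space set \<Rightarrow> ('a \<Rightarrow> real) \<Rightarrow> real \<Rightarrow> 'a set \<Rightarrow> ereal" where
  "energy \<Omega> p lam E = Per E \<Omega> - ereal (lam * (LINT x:E|lebesgue. p x))"

definition value_fun :: "'a::euclidean_space set set \<Rightarrow> 'a set \<Rightarrow> ('a \<Rightarrow> real) \<Rightarrow> real \<Rightarrow> ereal" where
  "value_fun \<T> \<Omega> p lam = Min (energy \<Omega> p lam ` simplicial_sets \<T>)"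

definition solution ::
    "'a::euclidean_space set set \<Rightarrow> 'a set \<Rightarrow> ('a \<Rightarrow> real) \<Rightarrow> real \<Rightarrow> 'a set \<Rightarrow> bool" where
  "solution \<T> \<Omega> p lam E \<longleftrightarrow> is_arg_min (energy \<Omega> p lam) (\<lambda>E. E \<in> simplicial_sets \<T>) E"

end

theory Submission
  imports Defs
begin

text \<open>
Consider the energy \<open>Per E \<Omega> - \<lambda> \<integral>\<^sub>E p\<close> on the finite class of simplicial sets. It splits this
class into two kinds of sets.

The trivial sets are \<open>{}\<close> and \<open>\<Omega>\<close>. Both have energy zero for every \<open>\<lambda>\<close>: their perimeter
relative to \<open>\<Omega>\<close> is zero, and so is the integral of \<open>p\<close> over \<open>\<Omega>\<close>, because the method optimizes
the constant part of its iterates (\<open>dual_variable_mean_0\<close>).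

All the other simplicial sets have positive perimeter (\<open>trivial_of_Per_0\<close>). For them, \<open>1 / \<lambda>\<^sub>k\<close>
being the maximal ratio of \<open>\<integral>\<^sub>E p\<close> and \<open>Per E \<Omega>\<close>, where \<open>\<lambda>\<^sub>k\<close> stands for \<open>lambda_bar\<close>, the energy
is nonnegative at \<open>\<lambda> = \<lambda>\<^sub>k\<close> and vanishes exactly for the maximizers of the ratio
(\<open>maximal_ratio_multiplier\<close>). Being affine in \<open>\<lambda>\<close> and positive at \<open>\<lambda> = 0\<close>, the energy of a
nontrivial set is positive for all \<open>0 \<le> \<lambda> < \<lambda>\<^sub>k\<close>, and that of a maximizer is negative beyond
\<open>\<lambda>\<^sub>k\<close>. The three claims follow from these signs.

The analytic part is the statement that a set of vanishing perimeter in a connected open set is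
trivial. Instead of mollifying its indicator function, the proof moves a bump function along a
segment: the derivative of the integral of the bump over the set is the integral of a divergence,
hence zero, so the bump cannot slide out of the set (\<open>translation_invariant_of_Per_0\<close>). The same
differentiation under the integral sign yields \<open>Per \<Omega> \<Omega> = 0\<close>. The Lipschitz condition on the
boundary is what makes \<open>\<Omega>\<close> the interior of its closure, hence a simplicial set.

The perimeter takes values in the extended reals. A set of infinite perimeter has ratio zero and
infinite energy, so it competes in neither problem.
\<close>

section \<open>Integrals of translates\<close>

lemma integrable_of_bounded_support:
  fixes f :: "'a::euclidean_space \<Rightarrow> real"
  assumes "f \<in> borel_measurable borel" "\<And>x. \<bar>f x\<bar> \<le> C" "\<And>x. f x \<noteq> 0 \<Longrightarrow> norm x \<le> R"
  shows "integrable lborel f"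
proof (rule Bochner_Integration.integrable_bound)
  show "integrable lborel (\<lambda>x. C * indicator (cball 0 R) x :: real)"
    using emeasure_lborel_cball_finite[of 0 R]
    by (intro integrable_mult_right integrable_real_indicator) auto
  show "f \<in> borel_measurable lborel" using assms(1) by simp
  have "C \<ge> 0" using assms(2)[of 0] by linarith
  then show "AE x in lborel. norm (f x) \<le> norm (C * indicator (cball 0 R) x)"
    using assms(2,3) by (intro AE_I2) (fastforce simp: indicator_def)
qed

lemma bounded_of_compact_support:
  fixes f :: "'a::euclidean_space \<Rightarrow> 'b::real_normed_vector"
  assumes "continuous_on UNIV f" and supp: "\<And>x. f x \<noteq> 0 \<Longrightarrow> norm x \<le> R"
  obtains B where "\<And>x. norm (f x) \<le> B"
proof -
  have "compact (f ` cball 0 R)"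
    using assms(1) by (intro compact_continuous_image) (auto intro: continuous_on_subset)
  then have "bounded (f ` cball 0 R)" by (rule compact_imp_bounded)
  then obtain B where B: "\<forall>x\<in>cball 0 R. norm (f x) \<le> B" unfolding bounded_iff by blast
  have "norm (f x) \<le> max B 0" for x
    using B supp[of x] by (cases "f x = 0") (fastforce simp: le_max_iff_disj)+
  then show thesis using that by blast
qed

lemma integrable_of_compact_support:
  fixes f :: "'a::euclidean_space \<Rightarrow> real"
  assumes "continuous_on UNIV f" "\<And>x. f x \<noteq> 0 \<Longrightarrow> norm x \<le> R"
  shows "integrable lborel f"
proof -
  obtain B where "\<And>x. norm (f x) \<le> B"
    using bounded_of_compact_support[OF assms] by blast
  then show ?thesis
    using assms
    by (intro integrable_of_bounded_support[of f B R]) (auto intro: borel_measurable_continuous_onI)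
qed

lemma derivative_zero_outside_support:
  fixes f :: "'a::real_normed_vector \<Rightarrow> 'b::real_normed_vector" and f' :: "'a \<Rightarrow>\<^sub>L 'b"
  assumes "(f has_derivative blinfun_apply f') (at x)" "x \<notin> closure {x. f x \<noteq> 0}"
  shows "f' = 0"
proof -
  have "((\<lambda>_. 0) has_derivative (\<lambda>_. 0)) (at x)" by (rule has_derivative_const)
  then have "(f has_derivative (\<lambda>_. 0)) (at x)"
  proof (rule has_derivative_transform_within_open)
    show "open (- closure {x. f x \<noteq> 0})" by (simp add: open_Compl)
    show "x \<in> - closure {x. f x \<noteq> 0}" using assms(2) by simp
    show "0 = f y" if "y \<in> - closure {x. f x \<noteq> 0}" for y
      using that closure_subset[of "{x. f x \<noteq> 0}"] by auto
  qed
  then have "blinfun_apply f' = (\<lambda>_. 0)" using assms(1) has_derivative_unique by blast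
  then show ?thesis by (intro blinfun_eqI) simp
qed

lemma derivative_bounded_of_compact_support:
  fixes f :: "'a::euclidean_space \<Rightarrow> real" and f' :: "'a \<Rightarrow> 'a \<Rightarrow>\<^sub>L real"
  assumes der: "\<And>x. (f has_derivative blinfun_apply (f' x)) (at x)"
    and cont: "continuous_on UNIV f'"
    and supp: "\<And>x. f x \<noteq> 0 \<Longrightarrow> norm x \<le> R"
  obtains C where "\<And>x. norm (f' x) \<le> C"
proof -
  have "closure {x. f x \<noteq> 0} \<subseteq> cball 0 R"
    using supp by (intro closure_minimal) auto
  then have zero: "f' x = 0" if "\<not> norm x \<le> R" for x
    using derivative_zero_outside_support[OF der[of x]] that by (meson mem_cball_0 subsetD)
  then show thesis using bounded_of_compact_support[OF cont, of R] that by blast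
qed

text \<open>Differentiation under the integral sign, by dominated convergence: \<open>f\<close> is Lipschitz, so the
difference quotients are bounded, and they vanish outside one fixed ball as long as the increment
of \<open>s\<close> stays bounded.\<close>
lemma has_derivative_integral_translate:
  fixes f :: "'a::euclidean_space \<Rightarrow> real" and f' :: "'a \<Rightarrow> 'a \<Rightarrow>\<^sub>L real"
  assumes der: "\<And>x. (f has_derivative blinfun_apply (f' x)) (at x)"
    and cont: "continuous_on UNIV f'"
    and supp: "\<And>x. f x \<noteq> 0 \<Longrightarrow> norm x \<le> R"
    and E: "E \<in> sets borel"
  shows "((\<lambda>s. LINT x:E|lborel. f (x + s *\<^sub>R h)) has_real_derivative
          (LINT x:E|lborel. f' (x + s *\<^sub>R h) h)) (at s)"
proof -
  obtain C where C: "\<And>x. norm (f' x) \<le> C"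
    using derivative_bounded_of_compact_support[OF der cont supp] by blast
  have lip: "\<bar>f y - f x\<bar> \<le> C * norm (y - x)" for x y
    using differentiable_bound[of UNIV f "\<lambda>x. blinfun_apply (f' x)" C y x] der C
    by (auto simp: norm_blinfun.rep_eq[symmetric])
  have fcont: "continuous_on UNIV f"
    using der by (meson continuous_at_imp_continuous_on has_derivative_continuous)
  then have fm [measurable]: "f \<in> borel_measurable borel"
    by (rule borel_measurable_continuous_onI)
  obtain B where B: "\<And>x. norm (f x) \<le> B"
    using bounded_of_compact_support[OF fcont supp] by blast
  note [measurable] = E
  have int: "integrable lborel (\<lambda>x. indicator E x * f (x + r *\<^sub>R h))" for r
  proof (rule integrable_of_bounded_support[where C = B and R = "R + norm (r *\<^sub>R h)"])
    show "\<bar>indicator E x * f (x + r *\<^sub>R h)\<bar> \<le> B" for x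
      using B[of "x + r *\<^sub>R h"] order_trans[OF norm_ge_zero B] by (auto simp: indicator_def)
    show "norm x \<le> R + norm (r *\<^sub>R h)" if "indicator E x * f (x + r *\<^sub>R h) \<noteq> 0" for x
      using supp[of "x + r *\<^sub>R h"] that norm_triangle_ineq4[of "x + r *\<^sub>R h" "r *\<^sub>R h"] by auto
  qed measurable
  define q where "q t x = indicator E x * ((f (x + (s + t) *\<^sub>R h) - f (x + s *\<^sub>R h)) / t)" for t x
  have "(\<lambda>n. LINT x|lborel. q (X n) x) \<longlonglongrightarrow>
        (LINT x|lborel. indicator E x * f' (x + s *\<^sub>R h) h)"
    if X: "X \<longlonglongrightarrow> 0" "\<And>n. X n \<noteq> 0" for X :: "nat \<Rightarrow> real"
  proof -
    \<comment> \<open>The ball of radius \<open>R'\<close> contains the supports of \<open>x \<mapsto> f (x + r h)\<close> for all the \<open>r\<close> that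
      occur.\<close>
    obtain A where A: "\<And>n. \<bar>X n\<bar> \<le> A"
      using Bseq_def X(1) convergentI convergent_imp_Bseq by (metis real_norm_def)
    define R' where "R' = R + (\<bar>s\<bar> + A) * norm h"
    have big: "norm x \<le> R'" if "norm (x + r *\<^sub>R h) \<le> R" "\<bar>r\<bar> \<le> \<bar>s\<bar> + A" for x r
    proof -
      have "norm x \<le> R + norm (r *\<^sub>R h)"
        using norm_triangle_ineq4[of "x + r *\<^sub>R h" "r *\<^sub>R h"] that by simp
      also have "\<dots> \<le> R'" using that(2) by (simp add: R'_def mult_right_mono)
      finally show ?thesis .
    qed
    show ?thesis
    proof (rule integral_dominated_convergence[where w = "\<lambda>x. C * norm h * indicator (cball 0 R') x"])
      have "continuous_on UNIV (\<lambda>x. f' (x + s *\<^sub>R h) h)"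
        by (intro continuous_intros continuous_on_compose2[OF cont]) auto
      then have [measurable]: "(\<lambda>x. f' (x + s *\<^sub>R h) h) \<in> borel_measurable borel"
        by (rule borel_measurable_continuous_onI)
      show "(\<lambda>x. indicator E x * f' (x + s *\<^sub>R h) h) \<in> borel_measurable lborel" by measurable
      show "q (X n) \<in> borel_measurable lborel" for n unfolding q_def by measurable
      show "integrable lborel (\<lambda>x. C * norm h * indicator (cball 0 R') x)"
        using emeasure_lborel_cball_finite[of 0 R']
        by (intro integrable_mult_right integrable_real_indicator) auto
      have "(\<lambda>n. (f (x + (s + X n) *\<^sub>R h) - f (x + s *\<^sub>R h)) / X n) \<longlonglongrightarrow> f' (x + s *\<^sub>R h) h" for x
      proof -
        have "((\<lambda>r. f (x + r *\<^sub>R h)) has_derivative (\<lambda>t. f' (x + s *\<^sub>R h) (t *\<^sub>R h))) (at s)"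
          by (rule has_derivative_compose[OF _ der]) (auto intro!: derivative_eq_intros)
        then have "((\<lambda>r. f (x + r *\<^sub>R h)) has_real_derivative f' (x + s *\<^sub>R h) h) (at s)"
          by (simp add: has_field_derivative_def blinfun.scaleR_right mult.commute[of _ "f' (x + s *\<^sub>R h) h"])
        then have "((\<lambda>t. (f (x + (s + t) *\<^sub>R h) - f (x + s *\<^sub>R h)) / t) \<longlongrightarrow> f' (x + s *\<^sub>R h) h) (at 0)"
          by (simp add: DERIV_def)
        then show ?thesis using X by (auto simp: tendsto_at_iff_sequentially comp_def)
      qed
      then show "AE x in lborel. (\<lambda>n. q (X n) x) \<longlonglongrightarrow> indicator E x * f' (x + s *\<^sub>R h) h"
        unfolding q_def by (intro AE_I2 tendsto_mult tendsto_const)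
      have "norm (q (X n) x) \<le> C * norm h * indicator (cball 0 R') x" for n x
      proof (cases "norm x \<le> R'")
        case True
        have "\<bar>f (x + (s + X n) *\<^sub>R h) - f (x + s *\<^sub>R h)\<bar> \<le> C * norm h * \<bar>X n\<bar>"
          using lip[of "x + (s + X n) *\<^sub>R h" "x + s *\<^sub>R h"] by (simp add: algebra_simps)
        then have "\<bar>(f (x + (s + X n) *\<^sub>R h) - f (x + s *\<^sub>R h)) / X n\<bar> \<le> C * norm h"
          using X(2)[of n] by (simp add: field_simps)
        moreover have "0 \<le> C * norm h"
          using C[of 0] norm_ge_zero[of "f' 0"] by (intro mult_nonneg_nonneg norm_ge_zero) linarith
        ultimately show ?thesis using True by (auto simp: q_def indicator_def abs_mult)
      next
        case False
        have "f (x + (s + X n) *\<^sub>R h) = 0" "f (x + s *\<^sub>R h) = 0"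
          using False big[of x "s + X n"] big[of x s] supp A[of n] by fastforce+
        then show ?thesis by (simp add: q_def False)
      qed
      then show "AE x in lborel. norm (q (X n) x) \<le> C * norm h * indicator (cball 0 R') x" for n
        by simp
    qed
  qed
  then have "((\<lambda>t. LINT x|lborel. q t x) \<longlongrightarrow> (LINT x|lborel. indicator E x * f' (x + s *\<^sub>R h) h)) (at 0)"
    by (auto simp: tendsto_at_iff_sequentially comp_def)
  moreover have "(LINT x|lborel. q t x) =
      ((LINT x:E|lborel. f (x + (s + t) *\<^sub>R h)) - (LINT x:E|lborel. f (x + s *\<^sub>R h))) / t" for t
  proof -
    let ?g = "\<lambda>r x. indicator E x * f (x + r *\<^sub>R h)"
    have "q t = (\<lambda>x. (?g (s + t) x - ?g s x) / t)"
      by (auto simp: q_def fun_eq_iff right_diff_distrib)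
    then have "(LINT x|lborel. q t x) = (LINT x|lborel. ?g (s + t) x - ?g s x) / t"
      by (simp only: integral_divide_zero)
    also have "(LINT x|lborel. ?g (s + t) x - ?g s x) =
        (LINT x|lborel. ?g (s + t) x) - (LINT x|lborel. ?g s x)"
      by (rule Bochner_Integration.integral_diff[OF int int])
    finally show ?thesis by (simp only: set_lebesgue_integral_def real_scaleR_def)
  qed
  ultimately show ?thesis by (simp add: DERIV_def set_lebesgue_integral_def)
qed

text \<open>A case of the divergence theorem that needs no boundary: over the whole space the integral of a
translate does not depend on the translation, and the integral in question is its derivative.\<close>
lemma integral_directional_derivative_eq_0:
  fixes f :: "'a::euclidean_space \<Rightarrow> real" and f' :: "'a \<Rightarrow> 'a \<Rightarrow>\<^sub>L real"
  assumes der: "\<And>x. (f has_derivative blinfun_apply (f' x)) (at x)"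
    and cont: "continuous_on UNIV f'"
    and supp: "\<And>x. f x \<noteq> 0 \<Longrightarrow> norm x \<le> R"
  shows "(LINT x|lborel. f' x h) = 0"
proof -
  have "f \<in> borel_measurable borel"
    using der by (intro borel_measurable_continuous_onI)
      (meson continuous_at_imp_continuous_on has_derivative_continuous)
  then have "(LINT x|distr lborel borel ((+) v). f x) = (LINT x|lborel. f (v + x))" for v
    by (subst integral_distr) auto
  then have "(LINT x|lborel. f (v + x)) = (LINT x|lborel. f x)" for v
    by (simp add: lborel_distr_plus)
  then have "(LINT x|lborel. f (x + v)) = (LINT x|lborel. f x)" for v
    by (simp only: add.commute[of _ v])
  then have "(\<lambda>s. LINT x:UNIV|lborel. f (x + s *\<^sub>R h)) = (\<lambda>s. LINT x|lborel. f x)"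
    by (simp add: set_lebesgue_integral_def)
  then show ?thesis
    using has_derivative_integral_translate[OF der cont supp, of UNIV h 0]
    by (auto simp: set_lebesgue_integral_def intro: DERIV_unique)
qed

section \<open>Sets of vanishing perimeter\<close>

lemma divergence_eq:
  assumes "(\<phi> has_derivative \<phi>') (at x)"
  shows "divergence \<phi> x = (\<Sum>b\<in>Basis. \<phi>' b \<bullet> b)"
  using frechet_derivative_at[OF assms] by (simp add: divergence_def)

lemma C1cE:
  fixes \<phi> :: "'a::euclidean_space \<Rightarrow> 'a"
  assumes "\<phi> \<in> C1c \<Omega>"
  obtains \<phi>' :: "'a \<Rightarrow> 'a \<Rightarrow>\<^sub>L 'a" and R where
    "\<And>x. (\<phi> has_derivative blinfun_apply (\<phi>' x)) (at x)" "continuous_on UNIV \<phi>'"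
    "\<And>x. \<phi> x \<noteq> 0 \<Longrightarrow> norm x \<le> R" "closure {x. \<phi> x \<noteq> 0} \<subseteq> \<Omega>"
    "\<And>x. divergence \<phi> x = (\<Sum>b\<in>Basis. \<phi>' x b \<bullet> b)"
    "divergence \<phi> \<in> borel_measurable borel"
proof -
  obtain \<phi>' :: "'a \<Rightarrow> 'a \<Rightarrow>\<^sub>L 'a" where der: "\<And>x. (\<phi> has_derivative blinfun_apply (\<phi>' x)) (at x)"
      and cont: "continuous_on UNIV \<phi>'" and c: "compact (closure {x. \<phi> x \<noteq> 0})"
      "closure {x. \<phi> x \<noteq> 0} \<subseteq> \<Omega>"
    using assms by (auto simp: C1c_def)
  have "bounded {x. \<phi> x \<noteq> 0}"
    using c(1) by (meson bounded_subset closure_subset compact_imp_bounded)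
  then obtain R where R: "\<And>x. \<phi> x \<noteq> 0 \<Longrightarrow> norm x \<le> R" by (auto simp: bounded_iff)
  have div: "divergence \<phi> = (\<lambda>x. \<Sum>b\<in>Basis. \<phi>' x b \<bullet> b)"
    using divergence_eq[OF der] by auto
  have "continuous_on UNIV (divergence \<phi>)"
    unfolding div by (intro continuous_intros cont)
  then have "divergence \<phi> \<in> borel_measurable borel" by (rule borel_measurable_continuous_onI)
  then show thesis using that der cont R c div by auto
qed

lemma lebesgue_divergence_integral_eq:
  fixes E \<Omega> :: "'a::euclidean_space set"
  assumes \<phi>: "\<phi> \<in> C1c \<Omega>" and E: "E \<in> sets borel" "E \<subseteq> \<Omega>"
  shows "(LINT x:\<Omega>|lebesgue. indicator E x * divergence \<phi> x) = (LINT x:E|lborel. divergence \<phi> x)"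
proof -
  have [measurable]: "divergence \<phi> \<in> borel_measurable borel" by (rule C1cE[OF \<phi>])
  note [measurable] = E(1)
  have "(LINT x:\<Omega>|lebesgue. indicator E x * divergence \<phi> x) =
      (LINT x|lebesgue. indicator E x * divergence \<phi> x)"
    unfolding set_lebesgue_integral_def
    using E(2) by (intro Bochner_Integration.integral_cong) (auto simp: indicator_def)
  also have "\<dots> = (LINT x|lborel. indicator E x * divergence \<phi> x)"
    by (rule integral_completion) measurable
  finally show ?thesis by (simp add: set_lebesgue_integral_def)
qed

lemma zero_in_test_fields:
  fixes \<Omega> :: "'a::euclidean_space set"
  shows "(\<lambda>_. 0) \<in> {\<phi> \<in> C1c \<Omega>. \<forall>x. norm (\<phi> x) \<le> 1}"
proof -
  have "((\<lambda>_. 0) has_derivative blinfun_apply 0) (at x)" for x :: 'a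
    by (simp add: zero_blinfun.rep_eq)
  then show ?thesis by (auto simp: C1c_def intro!: exI[of _ "\<lambda>_. 0"])
qed

text \<open>Test fields vanish outside \<open>\<Omega>\<close>, so their divergence may be integrated over the whole space, where
each partial derivative integrates to zero.\<close>
lemma Per_domain_eq_0:
  fixes \<Omega> :: "'a::euclidean_space set"
  assumes "open \<Omega>"
  shows "Per \<Omega> \<Omega> = 0"
proof -
  have zero: "(LINT x:\<Omega>|lebesgue. indicator \<Omega> x * divergence \<phi> x) = 0" if \<phi>: "\<phi> \<in> C1c \<Omega>" for \<phi>
  proof -
    obtain \<phi>' :: "'a \<Rightarrow> 'a \<Rightarrow>\<^sub>L 'a" and R where
      der: "\<And>x. (\<phi> has_derivative blinfun_apply (\<phi>' x)) (at x)" and cont: "continuous_on UNIV \<phi>'"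
      and R: "\<And>x. \<phi> x \<noteq> 0 \<Longrightarrow> norm x \<le> R" and cl: "closure {x. \<phi> x \<noteq> 0} \<subseteq> \<Omega>"
      and div: "\<And>x. divergence \<phi> x = (\<Sum>b\<in>Basis. \<phi>' x b \<bullet> b)"
      and "divergence \<phi> \<in> borel_measurable borel"
      using that by (rule C1cE[OF \<phi>])
    have supp: "\<phi>' x = 0" if "x \<notin> \<Omega>" for x
      using derivative_zero_outside_support[OF der] that cl by blast
    have comp: "integrable lborel (\<lambda>x. \<phi>' x b \<bullet> b)" "(LINT x|lborel. \<phi>' x b \<bullet> b) = 0" for b
    proof -
      let ?f = "\<lambda>x. \<phi> x \<bullet> b" and ?f' = "\<lambda>x. blinfun_inner_left b o\<^sub>L \<phi>' x"
      have d: "(?f has_derivative blinfun_apply (?f' x)) (at x)" for x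
        by (auto intro!: derivative_eq_intros der)
      have c: "continuous_on UNIV ?f'"
        by (intro bounded_bilinear.continuous_on[OF bounded_bilinear_blinfun_compose]
            continuous_on_const cont)
      have s: "norm x \<le> R" if "?f x \<noteq> 0" for x using R that by (metis inner_zero_left)
      show "(LINT x|lborel. \<phi>' x b \<bullet> b) = 0"
        using integral_directional_derivative_eq_0[OF d c s, of b] by simp
      have "closure {x. \<phi> x \<noteq> 0} \<subseteq> cball 0 R" using R by (intro closure_minimal) auto
      moreover have "x \<in> closure {x. \<phi> x \<noteq> 0}" if "\<phi>' x b \<bullet> b \<noteq> 0" for x
      proof -
        have "\<phi>' x \<noteq> 0" using that by auto
        then show ?thesis using derivative_zero_outside_support[OF der] by blast
      qed
      ultimately have "norm x \<le> R" if "\<phi>' x b \<bullet> b \<noteq> 0" for x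
        using that by (meson mem_cball_0 subsetD)
      then show "integrable lborel (\<lambda>x. \<phi>' x b \<bullet> b)"
        by (intro integrable_of_compact_support continuous_intros cont)
    qed
    have "(LINT x:\<Omega>|lborel. divergence \<phi> x) = (LINT x|lborel. divergence \<phi> x)"
      unfolding set_lebesgue_integral_def
      by (intro Bochner_Integration.integral_cong) (auto simp: div supp indicator_def)
    also have "\<dots> = 0" unfolding div using comp by simp
    finally show ?thesis
      using lebesgue_divergence_integral_eq[OF \<phi>, of \<Omega>] assms by simp
  qed
  then have "ereal (LINT x:\<Omega>|lebesgue. indicator \<Omega> x * divergence \<phi> x) = 0"
    if "\<phi> \<in> C1c \<Omega>" for \<phi> using that by (simp add: zero_ereal_def)
  then show ?thesis
    unfolding Per_def TV_def using zero_in_test_fields[of \<Omega>] by (intro SUP_eq_const) auto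
qed

lemma TV_nonneg: "0 \<le> TV u \<Omega>"
proof -
  have "divergence (\<lambda>_. 0) x = 0" for x :: 'a
    using divergence_eq[OF has_derivative_const, of 0 x] by simp
  then show ?thesis
    unfolding TV_def by (intro SUP_upper2[OF zero_in_test_fields]) auto
qed

lemma Per_empty: "Per {} \<Omega> = 0"
  unfolding Per_def TV_def using zero_in_test_fields[of \<Omega>]
  by (intro SUP_eq_const) (auto simp: set_lebesgue_integral_def zero_ereal_def)

text \<open>The supremum in \<open>TV\<close> runs over fields of norm at most \<open>1\<close>. Testing with \<open>\<phi>\<close> and \<open>- \<phi>\<close>, both
divided by a bound of \<open>\<phi>\<close>, turns the inequality \<open>TV u \<Omega> \<le> 0\<close> into an equation for every field.\<close>
lemma integral_divergence_eq_0_of_TV_0: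
  fixes \<phi> :: "'a::euclidean_space \<Rightarrow> 'a"
  assumes TV: "TV u \<Omega> = 0" and \<phi>: "\<phi> \<in> C1c \<Omega>"
  shows "(LINT x:\<Omega>|lebesgue. u x * divergence \<phi> x) = 0"
proof -
  obtain \<phi>' :: "'a \<Rightarrow> 'a \<Rightarrow>\<^sub>L 'a" and R where
    der: "\<And>x. (\<phi> has_derivative blinfun_apply (\<phi>' x)) (at x)" and cont: "continuous_on UNIV \<phi>'"
    and R: "\<And>x. \<phi> x \<noteq> 0 \<Longrightarrow> norm x \<le> R" and "closure {x. \<phi> x \<noteq> 0} \<subseteq> \<Omega>"
    and div: "\<And>x. divergence \<phi> x = (\<Sum>b\<in>Basis. \<phi>' x b \<bullet> b)"
    and "divergence \<phi> \<in> borel_measurable borel"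
    using that by (rule C1cE[OF \<phi>])
  have "continuous_on UNIV \<phi>"
    using der by (meson continuous_at_imp_continuous_on has_derivative_continuous)
  then obtain M where M: "\<And>x. norm (\<phi> x) \<le> M"
    using bounded_of_compact_support[OF _ R] by blast
  define N where "N = max M 1"
  have N: "norm (\<phi> x) \<le> N" "N > 0" for x
    using M[of x] by (auto simp: N_def)
  let ?I = "LINT x:\<Omega>|lebesgue. u x * divergence \<phi> x"
  have "c * ?I \<le> 0" if "\<bar>c\<bar> * N = 1" for c
  proof -
    have d: "((\<lambda>x. c *\<^sub>R \<phi> x) has_derivative blinfun_apply (c *\<^sub>R \<phi>' x)) (at x)" for x
      using has_derivative_scaleR_right[OF der[of x], of c] by (simp add: scaleR_blinfun.rep_eq)
    have c0: "c \<noteq> 0" using that by auto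
    have "(\<lambda>x. c *\<^sub>R \<phi> x) \<in> C1c \<Omega>"
      unfolding C1c_def using \<phi> c0 d
      by (auto simp: C1c_def intro!: exI[of _ "\<lambda>x. c *\<^sub>R \<phi>' x"] continuous_intros cont)
    moreover have "norm (c *\<^sub>R \<phi> x) \<le> 1" for x
      using mult_left_mono[OF N(1)[of x], of "\<bar>c\<bar>"] that by simp
    ultimately have "ereal (LINT x:\<Omega>|lebesgue. u x * divergence (\<lambda>x. c *\<^sub>R \<phi> x) x) \<le> TV u \<Omega>"
      unfolding TV_def by (intro SUP_upper) auto
    moreover have "divergence (\<lambda>x. c *\<^sub>R \<phi> x) x = c * divergence \<phi> x" for x
      using divergence_eq[OF d[of x]] by (simp add: div scaleR_blinfun.rep_eq sum_distrib_left)
    ultimately show ?thesis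
      using TV by (simp add: mult.left_commute[of _ c] zero_ereal_def)
  qed
  from this[of "1 / N"] this[of "- 1 / N"] N show ?thesis
    by (auto simp: field_simps zero_le_mult_iff)
qed

text \<open>The derivative of \<open>s \<mapsto> \<integral>\<^sub>E f (x + s h) dx\<close> is the integral over \<open>E\<close> of the divergence of the field
\<open>f (x + s h) h\<close>. If the support of \<open>f\<close> can be slid along the segment without leaving \<open>\<Omega>\<close>, this
field is admissible in the perimeter, and the derivative is zero.\<close>
lemma translation_invariant_of_Per_0:
  fixes f :: "'a::euclidean_space \<Rightarrow> real" and f' :: "'a \<Rightarrow> 'a \<Rightarrow>\<^sub>L real"
  assumes der: "\<And>x. (f has_derivative blinfun_apply (f' x)) (at x)"
    and cont: "continuous_on UNIV f'"
    and supp: "\<And>x. f x \<noteq> 0 \<Longrightarrow> x \<in> cball a r"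
    and path: "\<And>s. \<lbrakk>0 \<le> s; s \<le> 1\<rbrakk> \<Longrightarrow> cball (a - s *\<^sub>R h) r \<subseteq> \<Omega>"
    and E: "E \<in> sets borel" "E \<subseteq> \<Omega>" and Per: "Per E \<Omega> = 0"
  shows "(LINT x:E|lborel. f (x + h)) = (LINT x:E|lborel. f x)"
proof -
  have supp0: "norm x \<le> norm a + r" if "f x \<noteq> 0" for x
    using supp[OF that] norm_triangle_ineq2[of x a] by (simp add: dist_norm norm_minus_commute)
  let ?J = "\<lambda>s. LINT x:E|lborel. f (x + s *\<^sub>R h)"
  have dJ: "(?J has_real_derivative (LINT x:E|lborel. f' (x + s *\<^sub>R h) h)) (at s)" for s
    by (rule has_derivative_integral_translate[OF der cont supp0 E(1)])
  have zero: "(LINT x:E|lborel. f' (x + s *\<^sub>R h) h) = 0" if s: "0 \<le> s" "s \<le> 1" for s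
  proof -
    let ?\<phi> = "\<lambda>x. f (x + s *\<^sub>R h) *\<^sub>R h"
    let ?\<phi>' = "\<lambda>x. blinfun_scaleR_left h o\<^sub>L f' (x + s *\<^sub>R h)"
    have d0: "((\<lambda>x. f (x + s *\<^sub>R h)) has_derivative blinfun_apply (f' (x + s *\<^sub>R h))) (at x)" for x
      by (rule has_derivative_compose[OF _ der, where f = "\<lambda>x. x + s *\<^sub>R h"])
        (auto intro!: derivative_eq_intros)
    have d: "(?\<phi> has_derivative blinfun_apply (?\<phi>' x)) (at x)" for x
      using has_derivative_scaleR_left[OF d0[of x], of h] by (simp add: blinfun_compose.rep_eq comp_def)
    have c: "continuous_on UNIV ?\<phi>'"
      by (intro bounded_bilinear.continuous_on[OF bounded_bilinear_blinfun_compose]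
          continuous_on_const continuous_on_compose2[OF cont] continuous_intros) auto
    have sub: "closure {x. ?\<phi> x \<noteq> 0} \<subseteq> cball (a - s *\<^sub>R h) r"
    proof (intro closure_minimal subsetI)
      fix x assume "x \<in> {x. ?\<phi> x \<noteq> 0}"
      then have "x + s *\<^sub>R h \<in> cball a r" using supp by simp
      then show "x \<in> cball (a - s *\<^sub>R h) r" by (simp add: dist_norm algebra_simps)
    qed simp
    then have "compact (closure {x. ?\<phi> x \<noteq> 0})"
      by (meson bounded_cball bounded_subset closed_closure compact_eq_bounded_closed)
    then have \<phi>: "?\<phi> \<in> C1c \<Omega>"
      unfolding C1c_def mem_Collect_eq using d c order_trans[OF sub path[OF s]]
      by (intro conjI exI[of _ ?\<phi>'] allI)
    have div: "divergence ?\<phi> x = f' (x + s *\<^sub>R h) h" for x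
    proof -
      have "divergence ?\<phi> x = (\<Sum>b\<in>Basis. f' (x + s *\<^sub>R h) b * (h \<bullet> b))"
        using divergence_eq[OF d] by simp
      also have "\<dots> = f' (x + s *\<^sub>R h) (\<Sum>b\<in>Basis. (h \<bullet> b) *\<^sub>R b)"
        by (simp add: blinfun.sum_right blinfun.scaleR_right mult.commute)
      finally show ?thesis by (simp add: euclidean_representation)
    qed
    show ?thesis
      using integral_divergence_eq_0_of_TV_0[OF Per[unfolded Per_def] \<phi>]
        lebesgue_divergence_integral_eq[OF \<phi> E] by (simp add: div)
  qed
  have "?J 1 = ?J 0"
  proof (rule DERIV_isconst_end[where f = ?J])
    show "continuous_on {0..1} ?J"
      using dJ by (intro continuous_at_imp_continuous_on ballI DERIV_isCont) blast
    show "(?J has_real_derivative 0) (at s)" if "0 < s" "s < 1" for s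
      using dJ[of s] zero[of s] that by simp
  qed simp
  then show ?thesis by simp
qed

text \<open>The square makes the positive part differentiable at its kink; this is the profile of the bump
function below.\<close>
lemma DERIV_positive_part_squared:
  "((\<lambda>t::real. (max 0 t)\<^sup>2) has_real_derivative 2 * max 0 t) (at t)"
proof -
  consider "t > 0" | "t < 0" | "t = 0" by linarith
  then show ?thesis
  proof cases
    case 1
    have "((\<lambda>t. t\<^sup>2) has_real_derivative 2 * max 0 t) (at t)"
      using 1 by (auto intro!: derivative_eq_intros)
    then show ?thesis
      by (rule has_field_derivative_transform_within_open[where S = "{0<..}"]) (use 1 in auto)
  next
    case 2
    have "((\<lambda>t. 0) has_real_derivative 2 * max 0 t) (at t)" using 2 by simp
    then show ?thesis
      by (rule has_field_derivative_transform_within_open[where S = "{..<0}"]) (use 2 in auto)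
  next
    case 3
    have "((\<lambda>h::real. max 0 h) \<longlongrightarrow> max 0 0) (at 0)" by (intro tendsto_intros)
    moreover have "eventually (\<lambda>h::real. max 0 h = ((max 0 (0 + h))\<^sup>2 - (max 0 0)\<^sup>2) / h) (at 0)"
      by (rule eventually_at_filter[THEN iffD2]) (auto simp: max_def power2_eq_square)
    ultimately have "((\<lambda>h::real. ((max 0 (0 + h))\<^sup>2 - (max 0 0)\<^sup>2) / h) \<longlongrightarrow> max 0 0) (at 0)"
      by (rule Lim_transform_eventually)
    then show ?thesis by (simp add: 3 DERIV_def)
  qed
qed

lemma C1_bump:
  fixes a :: "'a::euclidean_space"
  assumes "r > 0"
  obtains f :: "'a \<Rightarrow> real" and f' :: "'a \<Rightarrow> 'a \<Rightarrow>\<^sub>L real" where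
    "\<And>x. (f has_derivative blinfun_apply (f' x)) (at x)" "continuous_on UNIV f'"
    "\<And>x. f x \<noteq> 0 \<Longrightarrow> x \<in> cball a r" "\<And>x. x \<in> ball a r \<Longrightarrow> f x > 0" "\<And>x. 0 \<le> f x"
proof -
  define g where "g x = r\<^sup>2 - (x - a) \<bullet> (x - a)" for x
  define f where "f x = (max 0 (g x))\<^sup>2" for x
  define f' where "f' x = (- 4 * max 0 (g x)) *\<^sub>R blinfun_inner_left (x - a)" for x
  show thesis
  proof (rule that[of f f'])
    show "(f has_derivative blinfun_apply (f' x)) (at x)" for x
    proof -
      have dg: "(g has_derivative (\<lambda>k. - 2 * (k \<bullet> (x - a)))) (at x)"
        unfolding g_def by (auto intro!: derivative_eq_intros simp: inner_commute)
      have "(f has_derivative (\<lambda>k. 2 * max 0 (g x) * (- 2 * (k \<bullet> (x - a))))) (at x)"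
        unfolding f_def
        by (rule has_derivative_compose[OF dg
              DERIV_positive_part_squared[unfolded has_field_derivative_def]])
      moreover have "blinfun_apply (f' x) = (\<lambda>k. 2 * max 0 (g x) * (- 2 * (k \<bullet> (x - a))))"
        by (auto simp: f'_def fun_eq_iff scaleR_blinfun.rep_eq minus_blinfun.rep_eq uminus_blinfun.rep_eq)
      ultimately show ?thesis by simp
    qed
    show "continuous_on UNIV f'"
      unfolding f'_def g_def
      by (intro continuous_intros bounded_linear.continuous_on[OF bounded_linear_blinfun_inner_left])
    have g: "g x > 0 \<longleftrightarrow> x \<in> ball a r" for x
    proof -
      have "g x > 0 \<longleftrightarrow> (norm (x - a))\<^sup>2 < r\<^sup>2" by (simp add: g_def dot_square_norm)
      also have "\<dots> \<longleftrightarrow> norm (x - a) < r"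
        using assms by (meson less_imp_le norm_ge_zero power2_less_imp_less power_strict_mono pos2)
      finally show ?thesis by (simp add: dist_norm norm_minus_commute)
    qed
    show "x \<in> cball a r" if "f x \<noteq> 0" for x
    proof -
      have "g x > 0" using that by (cases "g x > 0") (auto simp: f_def)
      then show ?thesis using g by (auto simp: less_imp_le)
    qed
    show "f x > 0" if "x \<in> ball a r" for x
      using g[of x] that by (simp add: f_def)
    show "0 \<le> f x" for x by (simp add: f_def)
  qed
qed

text \<open>If \<open>E\<close> is neither empty nor \<open>\<Omega>\<close>, connectedness gives a point \<open>x\<close> of \<open>\<Omega>\<close> on the boundary of
\<open>E\<close>. Because \<open>E\<close> is regular open, every ball around \<open>x\<close> contains small balls inside \<open>E\<close> as well
as small balls disjoint from \<open>E\<close>. A bump sliding from one of the former to one of the latter stays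
in \<open>\<Omega>\<close>, hence keeps its integral over \<open>E\<close>; but that integral is positive at first and zero at
the end. Regular openness excludes changes of \<open>E\<close> on null sets, which the perimeter cannot see.\<close>
lemma trivial_of_Per_0:
  fixes \<Omega> :: "'a::euclidean_space set"
  assumes \<Omega>: "open \<Omega>" "connected \<Omega>"
    and E: "E \<subseteq> \<Omega>" "interior (closure E) = E" and Per: "Per E \<Omega> = 0"
  shows "E = {} \<or> E = \<Omega>"
proof (rule ccontr)
  assume *: "\<not> (E = {} \<or> E = \<Omega>)"
  have "open E" using E(2) by (metis open_interior)
  have "\<not> closure E \<inter> \<Omega> \<subseteq> E"
  proof
    assume "closure E \<inter> \<Omega> \<subseteq> E"
    then have "E = \<Omega> \<inter> closure E" using closure_subset[of E] E(1) by auto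
    then have "closedin (top_of_set \<Omega>) E" by (metis closedin_closed_Int closed_closure)
    moreover have "openin (top_of_set \<Omega>) E" using \<open>open E\<close> E(1) by (simp add: open_subset)
    ultimately show False using \<Omega>(2) * unfolding connected_clopen by blast
  qed
  then obtain x where x: "x \<in> closure E" "x \<in> \<Omega>" "x \<notin> E" by auto
  obtain R where R: "R > 0" "ball x R \<subseteq> \<Omega>" using \<Omega>(1) x(2) open_contains_ball by blast
  obtain a where a: "a \<in> E \<inter> ball x R"
    using x(1) R(1) unfolding closure_approachable by (auto simp: dist_commute)
  obtain b where b: "b \<in> ball x R - closure E"
    using x(3) R(1) E(2) mem_interior[of x "closure E"] by fastforce
  obtain r1 where r1: "r1 > 0" "cball a r1 \<subseteq> E \<inter> ball x R"
    using a \<open>open E\<close> open_contains_cball[of "E \<inter> ball x R"] by (meson open_Int open_ball)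
  obtain r2 where r2: "r2 > 0" "cball b r2 \<subseteq> ball x R - closure E"
    using b open_contains_cball[of "ball x R - closure E"] by (meson open_Diff open_ball closed_closure)
  define r where "r = min r1 r2"
  have r: "r > 0" "cball a r \<subseteq> E \<inter> ball x R" "cball b r \<subseteq> ball x R - closure E"
    using r1 r2 by (auto simp: r_def)
  obtain f :: "'a \<Rightarrow> real" and f' :: "'a \<Rightarrow> 'a \<Rightarrow>\<^sub>L real" where
    der: "\<And>x. (f has_derivative blinfun_apply (f' x)) (at x)" and cont: "continuous_on UNIV f'"
    and supp: "\<And>x. f x \<noteq> 0 \<Longrightarrow> x \<in> cball a r" and pos: "\<And>x. x \<in> ball a r \<Longrightarrow> f x > 0"
    and nonneg: "\<And>x. 0 \<le> f x"
    using that by (rule C1_bump[OF r(1), of a])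
  \<comment> \<open>The balls around \<open>a\<close> and \<open>b\<close> lie in the same convex ball, so the balls in between do, too.\<close>
  have path: "cball (a - s *\<^sub>R (a - b)) r \<subseteq> \<Omega>" if s: "0 \<le> s" "s \<le> 1" for s
  proof
    fix y assume "y \<in> cball (a - s *\<^sub>R (a - b)) r"
    define w where "w = y - (a - s *\<^sub>R (a - b))"
    have "norm w \<le> r" using \<open>y \<in> _\<close> by (simp add: w_def dist_norm norm_minus_commute)
    then have "a + w \<in> cball a r" "b + w \<in> cball b r" by (simp_all add: dist_norm)
    then have "a + w \<in> ball x R" "b + w \<in> ball x R" using r by auto
    then have "(1 - s) *\<^sub>R (a + w) + s *\<^sub>R (b + w) \<in> ball x R"
      using s by (intro convexD[OF convex_ball]) auto
    moreover have "(1 - s) *\<^sub>R (a + w) + s *\<^sub>R (b + w) = y" by (simp add: w_def algebra_simps)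
    ultimately show "y \<in> \<Omega>" using R(2) by auto
  qed
  have "E \<in> sets borel" using \<open>open E\<close> by simp
  have eq: "(LINT y:E|lborel. f (y + (a - b))) = (LINT y:E|lborel. f y)"
    by (rule translation_invariant_of_Per_0[OF der cont supp path \<open>E \<in> sets borel\<close> E(1) Per])
  \<comment> \<open>After the translation the bump sits at \<open>b\<close>, away from \<open>E\<close>; before it, inside \<open>E\<close>.\<close>
  have "indicator E y *\<^sub>R f (y + (a - b)) = 0" for y
  proof (cases "f (y + (a - b)) = 0")
    case False
    then have "y \<in> cball b r" using supp[OF False] by (simp add: dist_norm algebra_simps)
    then have "y \<notin> E" using r(3) closure_subset[of E] by auto
    then show ?thesis by simp
  qed simp
  then have "(LINT y:E|lborel. f (y + (a - b))) = 0"
    unfolding set_lebesgue_integral_def by (simp only: Bochner_Integration.integral_zero)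
  moreover have "indicator E y *\<^sub>R f y = f y" for y
    using supp[of y] r(2) by (cases "f y = 0") (auto simp: indicator_def)
  ultimately have zero: "(LINT y|lborel. f y) = 0"
    using eq unfolding set_lebesgue_integral_def by (simp only:)
  have "continuous_on UNIV f"
    using der by (meson continuous_at_imp_continuous_on has_derivative_continuous)
  then have "integrable lborel f"
  proof (rule integrable_of_compact_support)
    show "norm y \<le> norm a + r" if "f y \<noteq> 0" for y
      using supp[OF that] norm_triangle_ineq2[of y a] by (simp add: dist_norm norm_minus_commute)
  qed
  then have "AE y in lborel. f y = 0"
    using zero nonneg by (subst (asm) integral_nonneg_eq_0_iff_AE) auto
  then have "AE y in lborel. y \<notin> ball a r" using pos by (elim eventually_mono) force
  then have "ball a r \<in> null_sets lborel" by (subst AE_iff_null_sets) auto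
  then show False using content_ball_pos[OF r(1), of a] by (simp add: null_sets_def measure_def)
qed

section \<open>Geometry of the domain and of simplicial sets\<close>

text \<open>Around a boundary point, a domain above a Lipschitz graph also has points strictly below the
graph, and these have a neighbourhood outside the domain. So no boundary point is interior to the
closure. This excludes cracks and punctures, and it makes \<open>\<Omega>\<close> itself a simplicial set.\<close>
lemma Lipschitz_domain_regular_open:
  fixes \<Omega> :: "'a::euclidean_space set"
  assumes lip: "strongly_lipschitz \<Omega>" and "open \<Omega>"
  shows "interior (closure \<Omega>) = \<Omega>"
proof
  show "\<Omega> \<subseteq> interior (closure \<Omega>)" using assms(2) closure_subset by (rule interior_maximal[rotated])
  show "interior (closure \<Omega>) \<subseteq> \<Omega>"
  proof (rule ccontr)
    assume "\<not> interior (closure \<Omega>) \<subseteq> \<Omega>"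
    then obtain x where x: "x \<in> interior (closure \<Omega>)" "x \<notin> \<Omega>" by auto
    then have "x \<in> frontier \<Omega>"
      using interior_subset interior_open[OF assms(2)] by (auto simp: frontier_def)
    then obtain U e g L where U: "open U" "x \<in> U" and e: "norm e = 1"
      and g: "L-lipschitz_on {z. z \<bullet> e = 0} g"
      and graph: "\<Omega> \<inter> U = {y \<in> U. g (y - (y \<bullet> e) *\<^sub>R e) < y \<bullet> e}"
      using lip unfolding strongly_lipschitz_def by meson
    let ?\<pi> = "\<lambda>y. y - (y \<bullet> e) *\<^sub>R e"
    have ee: "e \<bullet> e = 1" using e by (simp add: dot_square_norm)
    have cont: "continuous_on UNIV (\<lambda>y. g (?\<pi> y))"
      by (rule continuous_on_compose2[OF lipschitz_on_continuous_on[OF g]])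
        (auto intro!: continuous_intros simp: inner_diff_left ee)
    have "\<not> g (?\<pi> x) < x \<bullet> e" using graph x(2) U(2) by blast
    have "open (U \<inter> interior (closure \<Omega>))" using U(1) by auto
    then obtain d where d: "d > 0" "ball x d \<subseteq> U \<inter> interior (closure \<Omega>)"
      using x(1) U(2) open_contains_ball by blast
    \<comment> \<open>A point straight below \<open>x\<close>, hence strictly below the graph.\<close>
    define y where "y = x - (d / 2) *\<^sub>R e"
    have y: "y \<in> U" "y \<in> closure \<Omega>"
      using d e interior_subset[of "closure \<Omega>"] by (auto simp: y_def dist_norm subset_iff)
    have "y \<bullet> e = x \<bullet> e - d / 2" by (simp add: y_def inner_diff_left ee)
    moreover have "?\<pi> y = ?\<pi> x" by (simp add: y_def inner_diff_left ee algebra_simps)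
    ultimately have less: "y \<bullet> e < g (?\<pi> y)" using \<open>\<not> g (?\<pi> x) < x \<bullet> e\<close> d(1) by simp
    have "open (U \<inter> {y. y \<bullet> e < g (?\<pi> y)})"
      using U(1) cont by (intro open_Int open_Collect_less continuous_intros)
    moreover have "y \<in> U \<inter> {y. y \<bullet> e < g (?\<pi> y)}" using y(1) less by simp
    moreover have "U \<inter> {y. y \<bullet> e < g (?\<pi> y)} \<inter> \<Omega> = {}" using graph by force
    ultimately show False using y(2) by (meson disjoint_iff open_Int_closure_eq_empty)
  qed
qed

lemma simplicial_sets_regular_open:
  assumes "finite \<T>" "E \<in> simplicial_sets \<T>"
  shows "interior (closure E) = E"
proof -
  obtain \<S> where \<S>: "\<S> \<subseteq> \<T>" "E = interior (\<Union>T\<in>\<S>. closure T)"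
    using assms(2) by (auto simp: simplicial_sets_def)
  have "closed (\<Union>T\<in>\<S>. closure T)" using assms(1) \<S>(1) by (auto intro: finite_subset)
  then have "closure E \<subseteq> (\<Union>T\<in>\<S>. closure T)"
    using \<S>(2) interior_subset by (metis closure_minimal)
  then have "interior (closure E) \<subseteq> E" using \<S>(2) by (metis interior_mono)
  moreover have "E \<subseteq> interior (closure E)"
    using \<S>(2) by (metis closure_subset interior_maximal open_interior)
  ultimately show ?thesis by auto
qed

lemma triangulates_simplex_subset:
  assumes "triangulates \<T> \<Omega>" "interior (closure \<Omega>) = \<Omega>" "T \<in> \<T>"
  shows "T \<subseteq> \<Omega>"
proof -
  have "open T" using assms(1,3) unfolding triangulates_def by (metis open_interior)
  moreover have "T \<subseteq> closure \<Omega>"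
    using assms(1,3) closure_subset[of T] unfolding triangulates_def by auto
  ultimately show ?thesis using assms(2) by (metis interior_maximal)
qed

section \<open>The dual variable has mean zero\<close>

lemma P0_linear_combination:
  assumes "u \<in> P0 \<T>" "v \<in> P0 \<T>"
  shows "(\<lambda>x. a * u x + b * v x) \<in> P0 \<T>"
  using assms unfolding P0_def constant_on_def by (auto, metis)

lemma linear_continuous_on_P0_sum:
  fixes K :: "('a::euclidean_space \<Rightarrow> real) \<Rightarrow> 'y::real_normed_vector"
  assumes K: "linear_continuous_on_P0 \<T> \<Omega> K"
    and "finite A" "A \<subseteq> P0 \<T>" and w: "w \<in> P0 \<T>"
  shows "K (\<lambda>x. (\<Sum>v\<in>A. \<gamma> v * v x) + c * w x) = (\<Sum>v\<in>A. \<gamma> v *\<^sub>R K v) + c *\<^sub>R K w"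
proof -
  have add: "K (\<lambda>x. u x + v x) = K u + K v" if "u \<in> P0 \<T>" "v \<in> P0 \<T>" for u v
    using K that by (auto simp: linear_continuous_on_P0_def)
  have scale: "K (\<lambda>x. a * u x) = a *\<^sub>R K u" if "u \<in> P0 \<T>" for a u
    using K that by (auto simp: linear_continuous_on_P0_def)
  have scaled: "(\<lambda>x. a * u x) \<in> P0 \<T>" if "u \<in> P0 \<T>" for a u
    using P0_linear_combination[OF that that, of a 0] by simp
  have "(\<lambda>x. (\<Sum>v\<in>A. \<gamma> v * v x) + c * w x) \<in> P0 \<T> \<and>
    K (\<lambda>x. (\<Sum>v\<in>A. \<gamma> v * v x) + c * w x) = (\<Sum>v\<in>A. \<gamma> v *\<^sub>R K v) + c *\<^sub>R K w"
    using assms(2,3)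
  proof (induction A)
    case empty
    then show ?case using scaled[OF w] scale[OF w] by simp
  next
    case (insert v A)
    let ?u = "\<lambda>x. (\<Sum>v\<in>A. \<gamma> v * v x) + c * w x"
    have v: "v \<in> P0 \<T>" and IH: "?u \<in> P0 \<T>" "K ?u = (\<Sum>v\<in>A. \<gamma> v *\<^sub>R K v) + c *\<^sub>R K w"
      using insert by auto
    have eq: "(\<lambda>x. (\<Sum>v\<in>insert v A. \<gamma> v * v x) + c * w x) = (\<lambda>x. \<gamma> v * v x + ?u x)"
      using insert by (simp add: add.assoc)
    show ?case
      unfolding eq using P0_linear_combination[OF v IH(1), of "\<gamma> v" 1]
        add[OF scaled[OF v] IH(1), of "\<gamma> v"] scale[OF v] IH(2) insert
      by (simp add: add.assoc)
  qed
  then show ?thesis by simp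
qed

lemma fcgcg_active_set:
  assumes "fcgcg \<T> \<Omega> K F k \<A> u"
  shows "finite \<A> \<and> \<A> \<subseteq> P0 \<T>"
  using assms
proof induction
  case (step k \<A> u p vhat \<A>p \<gamma> c)
  have "vhat \<in> P0 \<T>"
    using step.hyps by (auto simp: is_arg_max_def extremal_mod_ae_def unit_TV_ball_def)
  then show ?case using step by auto
qed auto

text \<open>Every step of the method, the initial one included, minimizes over the constants jointly with the
weights; keeping the weights fixed shows that the constant part of the iterate is optimal. The
regularizing term \<open>\<Sum>\<gamma>\<close> does not see the constant.\<close>
lemma fcgcg_optimal_constant:
  fixes K :: "('a::euclidean_space \<Rightarrow> real) \<Rightarrow> 'y::real_inner"
  assumes K: "linear_continuous_on_P0 \<T> \<Omega> K" and one: "indicator \<Omega> \<in> P0 \<T>"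
    and "fcgcg \<T> \<Omega> K F k \<A> u"
  shows "F (K u) \<le> F (K u + t *\<^sub>R K (indicator \<Omega>))"
  using assms(3)
proof cases
  case (start c)
  have "K u = c *\<^sub>R K (indicator \<Omega>)"
    using K one start by (auto simp: linear_continuous_on_P0_def)
  then show ?thesis
    using start(4) by (simp add: is_arg_min_linorder flip: scaleR_add_left)
next
  case (step k' \<A>' u' p vhat \<A>p \<gamma> c)
  have "vhat \<in> P0 \<T>"
    using step by (auto simp: is_arg_max_def extremal_mod_ae_def unit_TV_ball_def)
  then have "finite \<A>p" "\<A>p \<subseteq> P0 \<T>" using step(8) fcgcg_active_set[OF step(4)] by auto
  then have Ku: "K u = (\<Sum>v\<in>\<A>p. \<gamma> v *\<^sub>R K v) + c *\<^sub>R K (indicator \<Omega>)"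
    using linear_continuous_on_P0_sum[OF K _ _ one] step(3) by simp
  let ?J = "\<lambda>c. F ((\<Sum>v\<in>\<A>p. \<gamma> v *\<^sub>R K v) + c *\<^sub>R K (indicator \<Omega>)) + (\<Sum>v\<in>\<A>p. \<gamma> v)"
  have "?J c \<le> ?J (c + t)"
    using step(9) unfolding is_arg_min_linorder by (auto dest!: spec[of _ \<gamma>] spec[of _ "c + t"])
  then show ?thesis by (simp add: Ku scaleR_add_left add.assoc)
qed

text \<open>By optimality of the constant, the derivative of \<open>F\<close> at \<open>K u\<close> in the direction \<open>K 1\<^sub>\<Omega>\<close> is zero,
and up to sign that derivative is the integral of \<open>p\<close>.\<close>
lemma dual_variable_mean_0:
  fixes K :: "('a::euclidean_space \<Rightarrow> real) \<Rightarrow> 'y::real_inner"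
  assumes K: "linear_continuous_on_P0 \<T> \<Omega> K" and one: "indicator \<Omega> \<in> P0 \<T>"
    and iterate: "fcgcg \<T> \<Omega> K F k \<A> u" and dual: "dual_variable \<T> \<Omega> K F u p"
  shows "(LINT x:\<Omega>|lebesgue. p x) = 0"
proof -
  obtain g where g: "GDERIV F (K u) :> g"
    and adj: "\<And>v. v \<in> P0 \<T> \<Longrightarrow> (LINT x:\<Omega>|lebesgue. p x * v x) = - (g \<bullet> K v)"
    using dual by (auto simp: dual_variable_def)
  let ?e = "K (indicator \<Omega>)"
  have "(F has_derivative (\<lambda>h. h \<bullet> g)) (at (K u + 0 *\<^sub>R ?e))"
    using g by (simp add: gderiv_def)
  then have "((\<lambda>t. F (K u + t *\<^sub>R ?e)) has_derivative (\<lambda>t. (t *\<^sub>R ?e) \<bullet> g)) (at 0)"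
    by (rule has_derivative_compose[where f = "\<lambda>t. K u + t *\<^sub>R ?e", rotated])
      (auto intro!: derivative_eq_intros)
  then have "((\<lambda>t. F (K u + t *\<^sub>R ?e)) has_real_derivative ?e \<bullet> g) (at 0)"
    by (simp add: has_field_derivative_def mult_commute_abs)
  then have "?e \<bullet> g = 0"
    by (rule DERIV_local_min[OF _ zero_less_one])
      (use fcgcg_optimal_constant[OF K one iterate] in auto)
  then have "(LINT x:\<Omega>|lebesgue. p x * indicator \<Omega> x) = 0"
    using adj[OF one] by (simp add: inner_commute)
  moreover have "(LINT x:\<Omega>|lebesgue. p x * indicator \<Omega> x) = (LINT x:\<Omega>|lebesgue. p x)"
    unfolding set_lebesgue_integral_def
    by (intro Bochner_Integration.integral_cong) (auto simp: indicator_def)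
  ultimately show ?thesis by simp
qed

section \<open>The parametric problems\<close>

text \<open>Dinkelbach's correspondence between maximizing \<open>I / P\<close> and minimizing \<open>P - l I\<close>: with \<open>l\<close> the
inverse of the maximal ratio, \<open>P - l I\<close> is nonnegative, and it vanishes exactly at the maximizers.
Infinite values of \<open>P\<close> are harmless: they make the ratio zero, below the maximum.\<close>
lemma maximal_ratio_multiplier:
  fixes P :: "'e \<Rightarrow> ereal" and I :: "'e \<Rightarrow> real"
  defines "R \<equiv> \<lambda>E. ereal (I E) / P E"
  assumes N: "finite N" "N \<noteq> {}" and pos: "\<And>E. E \<in> N \<Longrightarrow> 0 < P E"
    and ge1: "Max (R ` N) \<ge> 1"
  obtains l where "l > 0" "real_of_ereal (inverse (Max (R ` N))) = l"
    "\<And>E. E \<in> N \<Longrightarrow> ereal (l * I E) \<le> P E"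
    "\<And>E. E \<in> N \<Longrightarrow> P E = ereal (l * I E) \<longleftrightarrow> R E = Max (R ` N)"
proof -
  have "Max (R ` N) \<in> R ` N" using N by (intro Max_in) auto
  then obtain E0 where E0: "E0 \<in> N" "Max (R ` N) = R E0" by auto
  have "P E0 \<noteq> \<infinity>" using ge1 E0(2) by (auto simp: R_def)
  then obtain q where q: "P E0 = ereal q" "q > 0" using pos[OF E0(1)] by (cases "P E0") auto
  define m where "m = I E0 / q"
  have m: "Max (R ` N) = ereal m" using E0(2) q by (simp add: R_def m_def)
  then have "m \<ge> 1" using ge1 by (simp add: one_ereal_def)
  show thesis
  proof (rule that[of "1 / m"])
    show "1 / m > 0" using \<open>m \<ge> 1\<close> by simp
    show "real_of_ereal (inverse (Max (R ` N))) = 1 / m"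
      using \<open>m \<ge> 1\<close> by (simp add: m inverse_eq_divide)
    fix E assume E: "E \<in> N"
    have le: "R E \<le> ereal m" using N(1) E unfolding m[symmetric] by (intro Max_ge) auto
    show "ereal (1 / m * I E) \<le> P E"
      using pos[OF E] le \<open>m \<ge> 1\<close> by (cases "P E") (auto simp: R_def field_simps)
    show "P E = ereal (1 / m * I E) \<longleftrightarrow> R E = Max (R ` N)"
      using pos[OF E] \<open>m \<ge> 1\<close> unfolding m by (cases "P E") (auto simp: R_def field_simps)
  qed
qed

theorem proposition4p1:
  fixes \<Omega> :: "'a::euclidean_space set"
    and \<T> :: "'a set set"
    and K :: "('a \<Rightarrow> real) \<Rightarrow> 'y::{real_inner, complete_space}"
    and F :: "'y \<Rightarrow> real"
    and k :: nat
    and \<A> :: "('a \<Rightarrow> real) set"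
    and u p :: "'a \<Rightarrow> real"
  assumes dim: "DIM('a) \<ge> 2"
    and domain: "open \<Omega>" "connected \<Omega>" "\<Omega> \<noteq> {}" "bounded \<Omega>"
    and polyhedral: "polyhedral \<Omega>"
    and lipschitz: "strongly_lipschitz \<Omega>"
    and triangulates: "triangulates \<T> \<Omega>"
    and separable: "separable_space (euclidean :: 'y topology)"
    and K: "linear_continuous_on_P0 \<T> \<Omega> K"
    and F_smooth: "thrice_continuously_differentiable F"
    and F_convex: "strictly_convex F"
    and F_nonneg: "\<And>y. 0 \<le> F y"
    and F_unique_min: "\<And>y. \<exists>!c. is_arg_min (\<lambda>c. F (y + c *\<^sub>R K (indicator \<Omega>))) (\<lambda>_. True) c"
    and iterate: "fcgcg \<T> \<Omega> K F k \<A> u"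
    and dual: "dual_variable \<T> \<Omega> K F u p"
    and max_exists: "nontrivial_sets \<T> \<Omega> \<noteq> {}"
    and max_ge_1: "max_ratio \<T> \<Omega> p \<ge> 1"
  shows "(\<forall>lam\<ge>0. value_fun \<T> \<Omega> p lam \<le> 0 \<and> (value_fun \<T> \<Omega> p lam = 0 \<longleftrightarrow> lam \<le> lambda_bar \<T> \<Omega> p)) \<and>
    (\<forall>lam. 0 \<le> lam \<and> lam < lambda_bar \<T> \<Omega> p \<longrightarrow> {E. solution \<T> \<Omega> p lam E} = {{}, \<Omega>}) \<and>
    (\<forall>E \<in> simplicial_sets \<T>. Per E \<Omega> \<noteq> 0 \<longrightarrow>
       (solution \<T> \<Omega> p (lambda_bar \<T> \<Omega> p) E \<longleftrightarrow>
        is_arg_max (ratio \<Omega> p) (\<lambda>E'. E' \<in> nontrivial_sets \<T> \<Omega>) E))"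
proof -
  let ?S = "simplicial_sets \<T>" and ?N = "nontrivial_sets \<T> \<Omega>"
  let ?I = "\<lambda>E. LINT x:E|lebesgue. p x" and ?l = "lambda_bar \<T> \<Omega> p"
  have regular: "interior (closure \<Omega>) = \<Omega>"
    by (rule Lipschitz_domain_regular_open[OF lipschitz domain(1)])
  have cover: "closure \<Omega> = (\<Union>T\<in>\<T>. closure T)" and fin\<T>: "finite \<T>"
    using triangulates by (auto simp: triangulates_def)
  have "indicator \<Omega> \<in> P0 \<T>"
    using triangulates_simplex_subset[OF triangulates regular]
    by (auto simp: P0_def constant_on_def indicator_def)
  then have mean: "?I \<Omega> = 0" by (rule dual_variable_mean_0[OF K _ iterate dual])

  have "?S = (\<lambda>\<S>. interior (\<Union>T\<in>\<S>. closure T)) ` Pow \<T>"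
    by (auto simp: simplicial_sets_def)
  then have finS: "finite ?S" using fin\<T> by simp
  have "{} \<in> ?S" by (auto simp: simplicial_sets_def intro!: exI[of _ "{}"])
  have "\<Omega> \<in> ?S" using regular cover by (auto simp: simplicial_sets_def intro!: exI[of _ \<T>])
  have subset: "E \<subseteq> \<Omega>" if "E \<in> ?S" for E
  proof -
    obtain \<S> where "\<S> \<subseteq> \<T>" "E = interior (\<Union>T\<in>\<S>. closure T)"
      using \<open>E \<in> ?S\<close> by (auto simp: simplicial_sets_def)
    then have "E \<subseteq> interior (closure \<Omega>)" unfolding cover by (auto intro!: interior_mono)
    then show ?thesis using regular by simp
  qed
  \<comment> \<open>Only the two trivial sets have perimeter zero; the mean of \<open>p\<close> being zero, both have energy
    zero for every parameter.\<close>
  have trivial: "E \<in> ?S - ?N \<longleftrightarrow> E = {} \<or> E = \<Omega>" for E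
  proof
    assume "E \<in> ?S - ?N"
    then have "E \<in> ?S" "Per E \<Omega> = 0" by (auto simp: nontrivial_sets_def)
    then show "E = {} \<or> E = \<Omega>"
      using trivial_of_Per_0[OF domain(1,2) subset simplicial_sets_regular_open[OF fin\<T>]] by blast
  next
    assume "E = {} \<or> E = \<Omega>"
    then show "E \<in> ?S - ?N"
      using \<open>{} \<in> ?S\<close> \<open>\<Omega> \<in> ?S\<close> Per_empty Per_domain_eq_0[OF domain(1)]
      by (auto simp: nontrivial_sets_def)
  qed
  have pos: "0 < Per E \<Omega>" if "E \<in> ?N" for E
    using that TV_nonneg[of "indicator E" \<Omega>] by (auto simp: nontrivial_sets_def Per_def less_le)
  have "finite ?N" using finS by (simp add: nontrivial_sets_def)

  obtain l where l: "l > 0" "?l = l"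
    and bound: "\<And>E. E \<in> ?N \<Longrightarrow> ereal (l * ?I E) \<le> Per E \<Omega>"
    and tight: "\<And>E. E \<in> ?N \<Longrightarrow> Per E \<Omega> = ereal (l * ?I E) \<longleftrightarrow> ratio \<Omega> p E = max_ratio \<T> \<Omega> p"
    using maximal_ratio_multiplier[of ?N "\<lambda>E. Per E \<Omega>" ?I] \<open>finite ?N\<close> max_exists pos max_ge_1
    unfolding lambda_bar_def max_ratio_def ratio_def[abs_def] by blast

  have zero: "energy \<Omega> p lam {} = 0" "energy \<Omega> p lam \<Omega> = 0" for lam
    using Per_empty Per_domain_eq_0[OF domain(1)] mean
    by (auto simp: energy_def set_lebesgue_integral_def zero_ereal_def)
  have energy_pos: "0 < energy \<Omega> p lam E" if "0 \<le> lam" "lam < l" "E \<in> ?N" for lam E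
  proof (cases "?I E > 0")
    case True
    then have "lam * ?I E < l * ?I E" using that by simp
    then show ?thesis using bound[OF that(3)] by (cases "Per E \<Omega>") (auto simp: energy_def)
  next
    case False
    then have "lam * ?I E \<le> 0" using that by (simp add: mult_nonneg_nonpos)
    then show ?thesis using pos[OF that(3)] by (cases "Per E \<Omega>") (auto simp: energy_def)
  qed
  have energy_l: "0 \<le> energy \<Omega> p l E" "energy \<Omega> p l E = 0 \<longleftrightarrow> Per E \<Omega> = ereal (l * ?I E)"
    if "E \<in> ?N" for E
    using bound[OF that] by (cases "Per E \<Omega>"; auto simp: energy_def)+
  have energy_nonneg: "0 \<le> energy \<Omega> p lam E" if "0 \<le> lam" "lam \<le> l" "E \<in> ?S" for lam E
    using energy_pos[of lam E] energy_l(1)[of E] zero[of lam] trivial[of E] that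
    by (cases "E \<in> ?N"; cases "lam = l") auto
  have sol: "solution \<T> \<Omega> p lam E \<longleftrightarrow> E \<in> ?S \<and> energy \<Omega> p lam E = 0"
    if "0 \<le> lam" "lam \<le> l" for lam E
    using energy_nonneg[OF that] zero(1)[of lam] \<open>{} \<in> ?S\<close>
    unfolding solution_def is_arg_min_linorder by (metis order_antisym)

  have val: "value_fun \<T> \<Omega> p lam \<le> energy \<Omega> p lam E" if "E \<in> ?S" for lam E
    unfolding value_fun_def using finS that by (intro Min_le) auto
  \<comment> \<open>Beyond \<open>l\<close>, any maximizer of the ratio makes the energy negative.\<close>
  have "value_fun \<T> \<Omega> p lam \<le> 0" for lam
    using val[OF \<open>{} \<in> ?S\<close>] by (simp add: zero)
  moreover have "value_fun \<T> \<Omega> p lam = 0" if "0 \<le> lam" "lam \<le> l" for lam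
  proof (rule order_antisym)
    show "0 \<le> value_fun \<T> \<Omega> p lam"
      unfolding value_fun_def using finS \<open>{} \<in> ?S\<close> energy_nonneg[OF that]
      by (subst Min_ge_iff) auto
  qed fact
  moreover have "value_fun \<T> \<Omega> p lam < 0" if "l < lam" for lam
  proof -
    have "max_ratio \<T> \<Omega> p \<in> ratio \<Omega> p ` ?N"
      unfolding max_ratio_def using \<open>finite ?N\<close> max_exists by (intro Max_in) auto
    then obtain E where E: "E \<in> ?N" "Per E \<Omega> = ereal (l * ?I E)" using tight by fastforce
    then have "?I E > 0" using pos[OF E(1)] l(1) by (simp add: zero_less_mult_iff)
    then have "energy \<Omega> p lam E < 0" using E(2) that by (simp add: energy_def)
    moreover have "E \<in> ?S" using E(1) by (simp add: nontrivial_sets_def)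
    ultimately show ?thesis using val le_less_trans by blast
  qed
  ultimately have part1: "value_fun \<T> \<Omega> p lam \<le> 0 \<and> (value_fun \<T> \<Omega> p lam = 0 \<longleftrightarrow> lam \<le> l)"
    if "0 \<le> lam" for lam
    using that by (metis linorder_not_le less_irrefl)

  have part2: "{E. solution \<T> \<Omega> p lam E} = {{}, \<Omega>}" if "0 \<le> lam" "lam < l" for lam
  proof -
    have "solution \<T> \<Omega> p lam E \<longleftrightarrow> E \<in> ?S - ?N" for E
      using sol[of lam E] energy_pos[of lam E] zero[of lam] trivial[of E] that by force
    then show ?thesis using trivial by blast
  qed

  have part3: "solution \<T> \<Omega> p l E \<longleftrightarrow> is_arg_max (ratio \<Omega> p) (\<lambda>E'. E' \<in> ?N) E"
    if "E \<in> ?S" "Per E \<Omega> \<noteq> 0" for E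
  proof -
    have E: "E \<in> ?N" using that by (simp add: nontrivial_sets_def)
    have "solution \<T> \<Omega> p l E \<longleftrightarrow> ratio \<Omega> p E = max_ratio \<T> \<Omega> p"
      using sol[of l E] l(1) that(1) energy_l(2)[OF E] tight[OF E] by simp
    also have "\<dots> \<longleftrightarrow> is_arg_max (ratio \<Omega> p) (\<lambda>E'. E' \<in> ?N) E"
      unfolding max_ratio_def is_arg_max_linorder using \<open>finite ?N\<close> E
      by (subst eq_Max_iff) auto
    finally show ?thesis .
  qed
  show ?thesis using part1 part2 part3 l(2) by blast
qed

end
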